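(* Let $n\ge 1$ and let $S^n$ be the $n$-Schurr cube, i.e. the orientation of $Q_n$ with outmap $S^n(v)_i=v_i\oplus v_{i+1}$ for $i<n$ and $S^n(v)_n=v_n$. In $S^n$, every $n$-edge is in direct phase with its antipodal $n$-edge (certified by both pairs of antipodal endpoints), and all $n$-edges are in phase with each other. Moreover, no $n$-edge is in direct phase with any non-antipodal $n$-edge located in the opposite $1$-facet.
   Context: The $n$-cube $Q_n$ is the graph on $\{0,1\}^n$ where two vertices are adjacent iff they differ in exactly one coordinate; an edge whose endpoints differ in coordinate $i$ is an $i$-edge, and $E_i$ is the set of $i$-edges. Two vertices are antipodal if they differ in all coordinates; two $i$-edges are antipodal if one consists of the antipodes of the two endpoints of the other. The upper (lower) $i$-facet is the subgraph induced by all vertices with $v_i=1$ ($v_i=0$); these two are opposite. An orientation is a function $O:\{0,1\}^n\to\{0,1\}^n$ (outmap) such that $O(v)_i\ne O(v')_i$ whenever $v,v'$ differ exactly in coordinate $i$; $O(v)_i=1$ means the $i$-edge at $v$ is outgoing from $v$, and $O(v)_i=0$ means it is incoming. It is a unique sink orientation (USO) if every face (subcube) contains exactly one vertex with no outgoing edges inside the face. The $n$-Schurr cube is equivalently defined recursively: $S^1$ is a single edge oriented towards $0$; for $n\ge2$, $S^n$ has $S^{n-1}$ in the lower $n$-facet, $S^{n-1}$ with all $(n-1)$-edges reversed in the upper $n$-facet, and all $n$-edges oriented towards the lower $n$-facet. It is a USO. Phases: let $O$ be a USO. Two $i$-edges $e,e'\in E_i$ are in direct phase if there exist $v\in e$,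 $w\in e'$ such that $O(v)_j=O(w)_j$ for all $j\neq i$ with $v_j\ne w_j$; such a pair $v,w$ is said to certify this. Two $i$-edges are in phase if they are linked by a finite sequence of $i$-edges in which consecutive edges are in direct phase. *)

theory Defs
  imports "HOL-Library.FuncSet" "HOL-Library.Z2"
begin

text \<open>
  Vertices of the \<open>n\<close>-cube are extensional functions from the coordinates
  \<open>{1..n}\<close> to the two-element field \<open>bit\<close>, on which addition is exclusive or.
\<close>

definition cube :: "nat \<Rightarrow> (nat \<Rightarrow> bit) set" where
  "cube n = {1..n} \<rightarrow>\<^sub>E UNIV"

definition i_edges :: "nat \<Rightarrow> nat \<Rightarrow> (nat \<Rightarrow> bit) set set" where
  "i_edges n i = {{v, w} | v w. v \<in> cube n \<and> w \<in> cube n \<and> {j \<in> {1..n}. v j \<noteq> w j} = {i}}"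

definition antipode :: "nat \<Rightarrow> (nat \<Rightarrow> bit) \<Rightarrow> nat \<Rightarrow> bit" where
  "antipode n v = (\<lambda>j\<in>{1..n}. v j + 1)"

lemma antipode_iff:
  assumes "v \<in> cube n" "w \<in> cube n"
  shows "w = antipode n v \<longleftrightarrow> (\<forall>j\<in>{1..n}. v j \<noteq> w j)"
proof
  assume "w = antipode n v"
  then show "\<forall>j\<in>{1..n}. v j \<noteq> w j"
    by (auto simp: antipode_def)
next
  assume d: "\<forall>j\<in>{1..n}. v j \<noteq> w j"
  have "w j = v j + 1" if "j \<in> {1..n}" for j
  proof -
    have "v j \<noteq> w j"
      using d that by blast
    then show ?thesis
      by (cases "v j"; cases "w j") auto
  qed
  then show "w = antipode n v"
    using assms by (auto simp: antipode_def cube_def PiE_def extensional_def)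
qed

definition antipodal_edge :: "nat \<Rightarrow> (nat \<Rightarrow> bit) set \<Rightarrow> (nat \<Rightarrow> bit) set" where
  "antipodal_edge n e = antipode n ` e"

text \<open>The upper \<open>i\<close>-facet is \<open>facet n i 1\<close>, the lower one \<open>facet n i 0\<close>.\<close>

definition facet :: "nat \<Rightarrow> nat \<Rightarrow> bit \<Rightarrow> (nat \<Rightarrow> bit) set" where
  "facet n i b = {v \<in> cube n. v i = b}"

text \<open>The face through \<open>a\<close> that is spanned by the coordinates in \<open>I\<close>.\<close>

definition face :: "nat \<Rightarrow> (nat \<Rightarrow> bit) \<Rightarrow> nat set \<Rightarrow> (nat \<Rightarrow> bit) set" where
  "face n a I = {v \<in> cube n. \<forall>j\<in>{1..n} - I. v j = a j}"

definition orientation :: "nat \<Rightarrow> ((nat \<Rightarrow> bit) \<Rightarrow> nat \<Rightarrow> bit) \<Rightarrow> bool" where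
  "orientation n O' \<longleftrightarrow> O' \<in> cube n \<rightarrow> cube n \<and>
     (\<forall>i\<in>{1..n}. \<forall>v\<in>cube n. \<forall>w\<in>cube n.
        {j \<in> {1..n}. v j \<noteq> w j} = {i} \<longrightarrow> O' v i \<noteq> O' w i)"

definition uso :: "nat \<Rightarrow> ((nat \<Rightarrow> bit) \<Rightarrow> nat \<Rightarrow> bit) \<Rightarrow> bool" where
  "uso n O' \<longleftrightarrow> orientation n O' \<and>
     (\<forall>a\<in>cube n. \<forall>I\<subseteq>{1..n}. \<exists>!v. v \<in> face n a I \<and> (\<forall>i\<in>I. O' v i = 0))"

definition schurr :: "nat \<Rightarrow> (nat \<Rightarrow> bit) \<Rightarrow> nat \<Rightarrow> bit" where
  "schurr n v = (\<lambda>i\<in>{1..n}. if i < n then v i + v (i + 1) else v n)"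

definition certifies ::
  "nat \<Rightarrow> ((nat \<Rightarrow> bit) \<Rightarrow> nat \<Rightarrow> bit) \<Rightarrow> nat \<Rightarrow> (nat \<Rightarrow> bit) set \<Rightarrow> (nat \<Rightarrow> bit) set
    \<Rightarrow> (nat \<Rightarrow> bit) \<Rightarrow> (nat \<Rightarrow> bit) \<Rightarrow> bool" where
  "certifies n O' i e e' v w \<longleftrightarrow> v \<in> e \<and> w \<in> e' \<and>
     (\<forall>j\<in>{1..n}. j \<noteq> i \<and> v j \<noteq> w j \<longrightarrow> O' v j = O' w j)"

definition direct_phase ::
  "nat \<Rightarrow> ((nat \<Rightarrow> bit) \<Rightarrow> nat \<Rightarrow> bit) \<Rightarrow> nat \<Rightarrow> (nat \<Rightarrow> bit) set \<Rightarrow> (nat \<Rightarrow> bit) set \<Rightarrow> bool" where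
  "direct_phase n O' i e e' \<longleftrightarrow> e \<in> i_edges n i \<and> e' \<in> i_edges n i \<and>
     (\<exists>v w. certifies n O' i e e' v w)"

definition in_phase ::
  "nat \<Rightarrow> ((nat \<Rightarrow> bit) \<Rightarrow> nat \<Rightarrow> bit) \<Rightarrow> nat \<Rightarrow> (nat \<Rightarrow> bit) set \<Rightarrow> (nat \<Rightarrow> bit) set \<Rightarrow> bool" where
  "in_phase n O' i e e' \<longleftrightarrow> e \<in> i_edges n i \<and> e' \<in> i_edges n i \<and>
     (direct_phase n O' i)\<^sup>*\<^sup>* e e'"

text \<open>
  Phases are meant for unique sink orientations only; the definitions above do not
  need this property, and the Schurr cube has it.
\<close>

lemma schurr_orientation: "orientation n (schurr n)"
  unfolding orientation_def
proof (intro conjI ballI impI)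
  show "schurr n \<in> cube n \<rightarrow> cube n"
    by (auto simp: schurr_def cube_def)
next
  fix i and v w :: "nat \<Rightarrow> bit"
  assume i: "i \<in> {1..n}" and d: "{j \<in> {1..n}. v j \<noteq> w j} = {i}"
  have ne: "v i \<noteq> w i"
    using d by blast
  show "schurr n v i \<noteq> schurr n w i"
  proof (cases "i < n")
    case True
    then have "i + 1 \<in> {1..n}"
      by simp
    moreover have "i + 1 \<notin> {j \<in> {1..n}. v j \<noteq> w j}"
      unfolding d by simp
    ultimately have "v (i + 1) = w (i + 1)"
      by blast
    then show ?thesis
      using ne i True by (simp add: schurr_def del: add_bit_eq_xor)
  next
    case False
    then show ?thesis
      using ne i by (auto simp: schurr_def)
  qed
qed

lemma schurr_uso: "uso n (schurr n)"
  unfolding uso_def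
proof (intro conjI ballI allI impI)
  show "orientation n (schurr n)"
    by (rule schurr_orientation)
next
  fix a I
  assume a: "a \<in> cube n" and I: "I \<subseteq> {1..n}"
  have bit_sum: "x + y = 0 \<longleftrightarrow> x = y" for x y :: bit
    by (cases x; cases y) auto
  define s where
    "s = rec_nat 0 (\<lambda>k x. if n - k \<in> I then x else a (n - k))"
  have s: "s 0 = 0" "s (Suc k) = (if n - k \<in> I then s k else a (n - k))" for k
    by (simp_all add: s_def)
  define u where "u = (\<lambda>j\<in>{1..n}. s (Suc n - j))"
  have step: "s (Suc n - j) = (if j \<in> I then s (n - j) else a j)" if "j \<in> {1..n}" for j
    using s(2)[of "n - j"] that by (simp add: Suc_diff_le)
  have u: "u \<in> face n a I \<and> (\<forall>i\<in>I. schurr n u i = 0)"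
  proof (intro conjI ballI)
    show "u \<in> face n a I"
      using step by (auto simp: face_def cube_def u_def)
  next
    fix i assume i: "i \<in> I"
    then have iN: "i \<in> {1..n}"
      using I by blast
    show "schurr n u i = 0"
    proof (cases "i < n")
      case True
      have "u i = u (i + 1)"
        using step[OF iN] i iN True by (simp add: u_def)
      then show ?thesis
        using iN True by (simp add: schurr_def bit_sum del: add_bit_eq_xor)
    next
      case False
      then show ?thesis
        using step[OF iN] i iN s(1) by (simp add: schurr_def u_def)
    qed
  qed
  moreover have "v = u" if v: "v \<in> face n a I \<and> (\<forall>i\<in>I. schurr n v i = 0)" for v
  proof -
    have eq: "k < n \<longrightarrow> v (n - k) = u (n - k)" for k
    proof (induction k)
      case 0
      show ?case
      proof (cases "n \<in> I")
        case True
        then have "schurr n v n = 0" "schurr n u n = 0"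
          using u v by auto
        then show ?thesis
          by (auto simp: schurr_def)
      next
        case False
        then show ?thesis
          using u v by (auto simp: face_def)
      qed
    next
      case (Suc k)
      show ?case
      proof (intro impI)
        assume k: "Suc k < n"
        let ?j = "n - Suc k"
        have j: "?j \<in> {1..n}" "?j < n" "?j + 1 = n - k"
          using k by auto
        show "v ?j = u ?j"
        proof (cases "?j \<in> I")
          case True
          then have "schurr n v ?j = 0" "schurr n u ?j = 0"
            using u v by auto
          then have "v ?j = v (?j + 1)" "u ?j = u (?j + 1)"
            using j(1,2) by (simp_all add: schurr_def bit_sum del: add_bit_eq_xor)
          then show ?thesis
            using Suc.IH k j(3) by simp
        next
          case False
          then show ?thesis
            using u v j(1) by (auto simp: face_def)
        qed
      qed
    qed
    have "v j = u j" if "j \<in> {1..n}" for j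
      using eq[of "n - j"] that by auto
    then show ?thesis
      using u v unfolding face_def cube_def by (blast intro: PiE_ext)
  qed
  ultimately show "\<exists>!v. v \<in> face n a I \<and> (\<forall>i\<in>I. schurr n v i = 0)"
    by blast
qed

end

theory Submission
  imports Defs
begin

text \<open>
  For \<open>j < n\<close>, the entries \<open>schurr n v j\<close> and \<open>schurr n w j\<close> agree iff \<open>v\<close> and \<open>w\<close> differ
  either in both or in none of the coordinates \<open>j\<close> and \<open>j + 1\<close>. Hence complementing a suffix of
  coordinates \<open>k, \<dots>, n\<close> certifies a direct phase between \<open>n\<close>-edges; \<open>k = 1\<close> gives the antipode,
  and successive suffixes lead from any \<open>n\<close>-edge to any other. Conversely, if a certifying pair
  differs in coordinate \<open>1\<close>, then the condition propagates upwards and the pair is antipodal.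
\<close>

text \<open>Any endpoint determines an \<open>i\<close>-edge: the other vertex of the face can
  differ only in coordinate \<open>i\<close>, where just two values exist. Equality of two
  \<open>i\<close>-edges thus reduces to a shared vertex.\<close>

lemma i_edge_eq_face:
  assumes "e \<in> i_edges n i" "v \<in> e"
  shows "i \<in> {1..n}" "v \<in> cube n" "e = face n v {i}"
proof -
  from assms(1) obtain a b where e: "e = {a, b}" and ab: "a \<in> cube n" "b \<in> cube n"
    and d: "{j \<in> {1..n}. a j \<noteq> b j} = {i}"
    unfolding i_edges_def by blast
  show i: "i \<in> {1..n}"
    using d by blast
  show v: "v \<in> cube n"
    using assms(2) e ab by blast
  have eq: "a j = b j" if "j \<in> {1..n} - {i}" for j
    using d that by blast
  have ne: "a i \<noteq> b i"
    using d by blast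
  have "w \<in> {a, b}" if w: "w \<in> cube n" "\<forall>j\<in>{1..n} - {i}. w j = v j" for w
  proof -
    have *: "w j = a j" "w j = b j" if "j \<in> {1..n} - {i}" for j
      using w(2) eq[OF that] assms(2) e that by auto
    \<comment> \<open>The distinct values \<open>a i\<close> and \<open>b i\<close> exhaust the type
      \<open>bit\<close>.\<close>
    have "w i = a i \<or> w i = b i"
      using ne by (cases "w i"; cases "a i"; cases "b i") auto
    then show ?thesis
    proof
      assume "w i = a i"
      then have "w j = a j" if "j \<in> {1..n}" for j
        using *(1) that by (cases "j = i") auto
      then show ?thesis
        using w(1) ab(1) unfolding cube_def by (blast intro: PiE_ext)
    next
      assume "w i = b i"
      then have "w j = b j" if "j \<in> {1..n}" for j
        using *(2) that by (cases "j = i") auto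
      then show ?thesis
        using w(1) ab(2) unfolding cube_def by (blast intro: PiE_ext)
    qed
  qed
  moreover have "w j = v j" if "w \<in> {a, b}" "j \<in> {1..n} - {i}" for w j
    using that(1) assms(2) e eq[OF that(2)] by auto
  ultimately show "e = face n v {i}"
    using ab unfolding e face_def by blast
qed

lemma face_singleton_in_i_edges:
  assumes "i \<in> {1..n}" "v \<in> cube n"
  shows "face n v {i} \<in> i_edges n i"
proof -
  let ?w = "v(i := v i + 1)"
  have w: "?w \<in> cube n"
    using assms by (auto simp: cube_def PiE_def extensional_def)
  have "v i \<noteq> v i + 1"
    by (cases "v i") auto
  then have "{j \<in> {1..n}. v j \<noteq> ?w j} = {i}"
    using assms(1) by auto
  then have e: "{v, ?w} \<in> i_edges n i"
    using assms(2) w unfolding i_edges_def by blast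
  then show ?thesis
    using i_edge_eq_face(3)[OF e, of v] by simp
qed

lemma antipode_in_cube: "antipode n v \<in> cube n"
  by (simp add: antipode_def cube_def)

lemma antipodal_edge_in_i_edges:
  assumes "e \<in> i_edges n i"
  shows "antipodal_edge n e \<in> i_edges n i"
proof -
  from assms obtain a b where e: "e = {a, b}" and d: "{j \<in> {1..n}. a j \<noteq> b j} = {i}"
    unfolding i_edges_def by blast
  have "{j \<in> {1..n}. antipode n a j \<noteq> antipode n b j} = {i}"
    using d by (auto simp: antipode_def simp del: add_bit_eq_xor)
  moreover have "antipodal_edge n e = {antipode n a, antipode n b}"
    by (simp add: antipodal_edge_def e)
  ultimately show ?thesis
    unfolding i_edges_def using antipode_in_cube by blast
qed

text \<open>Equality of the two sums rearranges to \<open>v j + w j = v (j + 1) + w (j + 1)\<close>,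
  and a sum of two bits is 1 exactly when they differ.\<close>

lemma schurr_eq_iff:
  assumes "1 \<le> j" "j < n"
  shows "schurr n v j = schurr n w j \<longleftrightarrow> (v j \<noteq> w j \<longleftrightarrow> v (j + 1) \<noteq> w (j + 1))"
  using assms by (cases "v j"; cases "w j"; cases "v (j + 1)"; cases "w (j + 1)")
    (simp_all add: schurr_def)

text \<open>If \<open>j < n\<close> lies in the suffix, so does \<open>j + 1\<close>, hence the
  outmaps agree at \<open>j\<close>. At \<open>n\<close> they would disagree, but this coordinate is
  exempt for \<open>n\<close>-edges.\<close>

lemma certifies_suffix:
  assumes "v \<in> e" "w \<in> e'" "\<And>j. j \<in> {1..n} \<Longrightarrow> v j \<noteq> w j \<longleftrightarrow> k \<le> j"
  shows "certifies n (schurr n) n e e' v w"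
  unfolding certifies_def
proof (intro conjI ballI impI assms(1,2))
  fix j assume j: "j \<in> {1..n}" "j \<noteq> n \<and> v j \<noteq> w j"
  then have "k \<le> j" "j + 1 \<in> {1..n}"
    using assms(3) by auto
  then show "schurr n v j = schurr n w j"
    using j assms(3)[of "j + 1"] schurr_eq_iff[of j n v w] by auto
qed

lemma certifies_antipode:
  assumes "v \<in> e"
  shows "certifies n (schurr n) n e (antipodal_edge n e) v (antipode n v)"
proof (rule certifies_suffix[where k = 1])
  show "v j \<noteq> antipode n v j \<longleftrightarrow> 1 \<le> j" if "j \<in> {1..n}" for j
    using that by (cases "v j") (auto simp: antipode_def)
qed (use assms in \<open>auto simp: antipodal_edge_def\<close>)

lemma direct_phase_antipodal_edge:
  assumes "e \<in> i_edges n n"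
  shows "direct_phase n (schurr n) n e (antipodal_edge n e)"
proof -
  obtain v where "v \<in> e"
    using assms unfolding i_edges_def by blast
  then show ?thesis
    using assms antipodal_edge_in_i_edges[OF assms] certifies_antipode
    unfolding direct_phase_def by blast
qed

text \<open>The induction runs downwards from \<open>k = n\<close>, where agreement below
  \<open>n\<close> forces the edges to coincide. Each step repairs coordinate \<open>k\<close> of
  \<open>v\<close>, which moves the edge \<open>e\<close>; hence \<open>e\<close> and
  \<open>v\<close> are generalised while \<open>e'\<close> and \<open>w\<close> stay fixed.\<close>

lemma direct_phase_rtranclp_if_agree_below:
  assumes "k \<le> n" "e \<in> i_edges n n" "e' \<in> i_edges n n" "v \<in> e" "w \<in> e'"
    and "\<forall>j\<in>{1..<k}. v j = w j"
  shows "(direct_phase n (schurr n) n)\<^sup>*\<^sup>* e e'"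
  using assms
proof (induction k arbitrary: e v rule: inc_induct)
  case base
  then have "e = face n v {n}" "e' = face n w {n}"
    by (simp_all add: i_edge_eq_face(3))
  moreover have "{1..n} - {n} = {1..<n}"
    by auto
  ultimately have "e = e'"
    using base.prems by (auto simp: face_def)
  then show ?case
    by simp
next
  case (step k)
  show ?case
  \<comment> \<open>Index 0 is no coordinate, so \<open>k = 0\<close> leaves nothing to
    repair.\<close>
  proof (cases "k = 0 \<or> v k = w k")
    case True
    then have "\<forall>j\<in>{1..<Suc k}. v j = w j"
      using step.prems(5) by (auto simp: less_Suc_eq)
    then show ?thesis
      using step.IH step.prems by blast
  next
    case False
    \<comment> \<open>Flipping the suffix from \<open>k\<close> corrects coordinate \<open>k\<close>
      and keeps the agreement below it. Agreement above \<open>k\<close> may be lost, but the later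
      steps flip those coordinates as required.\<close>
    define u where "u = (\<lambda>j\<in>{1..n}. if k \<le> j then v j + 1 else v j)"
    have diff: "v j \<noteq> u j \<longleftrightarrow> k \<le> j" if "j \<in> {1..n}" for j
      using that by (cases "v j") (auto simp: u_def)
    have u: "u \<in> cube n"
      by (simp add: u_def cube_def)
    let ?f = "face n u {n}"
    have f: "?f \<in> i_edges n n" "u \<in> ?f"
      using face_singleton_in_i_edges[OF _ u] i_edge_eq_face(1)[OF step.prems(1,3)] u
      by (auto simp: face_def)
    have "direct_phase n (schurr n) n e ?f"
      unfolding direct_phase_def
      using certifies_suffix[OF step.prems(3) f(2) diff] step.prems(1) f(1) by blast
    moreover have "\<forall>j\<in>{1..<Suc k}. u j = w j"
    proof
      fix j assume j: "j \<in> {1..<Suc k}"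
      then have jn: "j \<in> {1..n}"
        using step.hyps by auto
      show "u j = w j"
      proof (cases "j = k")
        case True
        then have "v j \<noteq> u j" "v j \<noteq> w j"
          using diff[OF jn] False by auto
        then show ?thesis
          by (cases "v j"; cases "u j"; cases "w j") auto
      next
        case False
        then show ?thesis
          using diff[OF jn] j step.prems(5) by auto
      qed
    qed
    then have "(direct_phase n (schurr n) n)\<^sup>*\<^sup>* ?f e'"
      using step.IH f step.prems(2,4) by blast
    ultimately show ?thesis
      by (rule converse_rtranclp_into_rtranclp)
  qed
qed

lemma in_phase_schurr:
  assumes "e \<in> i_edges n n" "e' \<in> i_edges n n"
  shows "in_phase n (schurr n) n e e'"
proof -
  obtain v w where "v \<in> e" "w \<in> e'"
    using assms unfolding i_edges_def by blast
  \<comment> \<open>For \<open>k = 0\<close> the agreement hypothesis is vacuous, so arbitrary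
    endpoints serve.\<close>
  then show ?thesis
    using direct_phase_rtranclp_if_agree_below[of 0 n] assms by (simp add: in_phase_def)
qed

lemma certifies_first_differ_imp_antipode:
  assumes c: "certifies n (schurr n) n e e' v w"
    and "v \<in> cube n" "w \<in> cube n" "v 1 \<noteq> w 1"
  shows "w = antipode n v"
proof -
  have "v j \<noteq> w j" if "1 \<le> j" "j \<le> n" for j
    using that
  proof (induction j rule: dec_induct)
    case base
    show ?case
      using assms(4) by simp
  next
    case (step j)
    then have "v j \<noteq> w j"
      by simp
    \<comment> \<open>Here \<open>j < n\<close>, so the exemption of coordinate \<open>n\<close>
      does not apply and the certificate yields equal outmaps, which carry the difference on to
      \<open>j + 1\<close>.\<close>
    moreover from this have "schurr n v j = schurr n w j"
      using c step.hyps step.prems unfolding certifies_def by auto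
    ultimately show ?case
      using schurr_eq_iff[of j n v w] step.hyps step.prems by simp
  qed
  then show ?thesis
    using antipode_iff[OF assms(2,3)] by simp
qed

text \<open>Lying in opposite \<open>1\<close>-facets makes every certifying pair differ in
  coordinate 1, so the pair is antipodal.\<close>

lemma direct_phase_opposite_imp_antipodal_edge:
  assumes d: "direct_phase n (schurr n) n e e'"
    and "e \<subseteq> facet n 1 b" "e' \<subseteq> facet n 1 c" "b \<noteq> c"
  shows "e' = antipodal_edge n e"
proof -
  from d obtain v w where e: "e \<in> i_edges n n" "e' \<in> i_edges n n"
    and vw: "certifies n (schurr n) n e e' v w"
    unfolding direct_phase_def by blast
  then have m: "v \<in> e" "w \<in> e'"
    by (simp_all add: certifies_def)
  then have "w = antipode n v"
    using assms(2-4) certifies_first_differ_imp_antipode[OF vw] by (auto simp: facet_def)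
  then have "w \<in> antipodal_edge n e"
    using m(1) by (simp add: antipodal_edge_def)
  \<comment> \<open>The \<open>n\<close>-edges \<open>e'\<close> and
    \<open>antipodal_edge n e\<close> share the vertex \<open>w\<close>, so both equal
    \<open>face n w {n}\<close>.\<close>
  then show ?thesis
    using i_edge_eq_face(3) antipodal_edge_in_i_edges e m(2) by metis
qed

theorem lemma28:
  fixes n :: nat
  assumes "n \<ge> 1"
  shows "(\<forall>e \<in> i_edges n n.
            direct_phase n (schurr n) n e (antipodal_edge n e) \<and>
            (\<forall>v\<in>e. certifies n (schurr n) n e (antipodal_edge n e) v (antipode n v)))
       \<and> (\<forall>e \<in> i_edges n n. \<forall>e' \<in> i_edges n n. in_phase n (schurr n) n e e')
       \<and> (\<forall>e \<in> i_edges n n. \<forall>e' \<in> i_edges n n. \<forall>b c.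
            e \<subseteq> facet n 1 b \<and> e' \<subseteq> facet n 1 c \<and> b \<noteq> c \<and> e' \<noteq> antipodal_edge n e
            \<longrightarrow> \<not> direct_phase n (schurr n) n e e')"
proof (intro conjI ballI allI impI)
  fix e e' b c
  assume "e \<subseteq> facet n 1 b \<and> e' \<subseteq> facet n 1 c \<and> b \<noteq> c \<and> e' \<noteq> antipodal_edge n e"
  then show "\<not> direct_phase n (schurr n) n e e'"
    using direct_phase_opposite_imp_antipodal_edge by blast
qed (simp_all add: direct_phase_antipodal_edge certifies_antipode in_phase_schurr)

end
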